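(* Let $D=\mathbb{Z}[\omega]$ with $\omega=\frac{-1+i\sqrt{3}}{2}$, and let $p$ and $q$ be rational primes. (1) If $q\equiv 2\pmod 3$, then $q$ is prime in $D$. (2) If $p\equiv 1\pmod 3$, then $p=N\pi=\pi\overline{\pi}$ for some prime $\pi$ of $D$. (3) $3=-\omega^{2}(1-\omega)^{2}$, and $1-\omega$ is prime in $D$.
   Context: A rational prime is a prime of $\mathbb{Z}$. For $\alpha=a+b\omega\in D$ with $a,b\in\mathbb{Z}$, the norm is $N\alpha=\alpha\overline{\alpha}=a^2-ab+b^2$. *)

theory Defs
  imports Complex_Main "HOL-Algebra.Ring_Divisibility" "HOL-Number_Theory.Cong"
begin

definition eis_omega :: complex where
  "eis_omega = (-1 + \<i> * complex_of_real (sqrt 3)) / 2"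

(* The ring Z[omega], realised as a subring of the complex numbers. *)
definition eis_ring :: "complex ring" where
  "eis_ring = \<lparr>carrier = {of_int a + of_int b * eis_omega | a b :: int. True},
     mult = (*), one = 1, zero = 0, add = (+)\<rparr>"

definition eis_norm :: "complex \<Rightarrow> complex" where
  "eis_norm \<alpha> = \<alpha> * cnj \<alpha>"

(* ring_prime does not by itself require the element to lie in the carrier. *)
definition eis_prime :: "complex \<Rightarrow> bool" where
  "eis_prime \<alpha> \<longleftrightarrow> \<alpha> \<in> carrier eis_ring \<and> ring_prime\<^bsub>eis_ring\<^esub> \<alpha>"

lemma eis_omega_squared: "eis_omega\<^sup>2 = - 1 - eis_omega"
  by (simp add: eis_omega_def complex_eq_iff power2_eq_square field_simps)

lemma cnj_eis_omega: "cnj eis_omega = - 1 - eis_omega"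
  by (simp add: eis_omega_def complex_eq_iff field_simps)

lemma eis_norm_eq:
  "eis_norm (of_int a + of_int b * eis_omega) = of_int (a\<^sup>2 - a * b + b\<^sup>2)"
proof -
  have "eis_norm (of_int a + of_int b * eis_omega) =
      of_int a ^ 2 - of_int a * of_int b - of_int b ^ 2 * (eis_omega + eis_omega\<^sup>2)"
    by (simp add: eis_norm_def cnj_eis_omega power2_eq_square algebra_simps)
  then show ?thesis
    by (simp add: eis_omega_squared)
qed

lemma eis_ring_memI: "of_int a + of_int b * eis_omega \<in> carrier eis_ring"
  by (auto simp: eis_ring_def)

lemma eis_ring_memE:
  assumes "x \<in> carrier eis_ring"
  obtains a b where "x = of_int a + of_int b * eis_omega"
  using assms by (auto simp: eis_ring_def)

lemma domain_eis_ring: "domain eis_ring"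
proof -
  have add: "x + y \<in> carrier eis_ring"
    if x: "x \<in> carrier eis_ring" and y: "y \<in> carrier eis_ring" for x y
  proof -
    obtain a b c d where "x = of_int a + of_int b * eis_omega" "y = of_int c + of_int d * eis_omega"
      using x y by (metis eis_ring_memE)
    then have "x + y = of_int (a + c) + of_int (b + d) * eis_omega"
      by (simp add: algebra_simps)
    then show ?thesis by (metis eis_ring_memI)
  qed
  have mult: "x * y \<in> carrier eis_ring"
    if x: "x \<in> carrier eis_ring" and y: "y \<in> carrier eis_ring" for x y
  proof -
    obtain a b c d where xy: "x = of_int a + of_int b * eis_omega" "y = of_int c + of_int d * eis_omega"
      using x y by (metis eis_ring_memE)
    have "x * y = of_int a * of_int c + (of_int a * of_int d + of_int b * of_int c) * eis_omega
        + of_int b * of_int d * eis_omega\<^sup>2"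
      by (simp add: xy power2_eq_square algebra_simps)
    also have "\<dots> = of_int (a * c - b * d) + of_int (a * d + b * c - b * d) * eis_omega"
      by (simp add: eis_omega_squared algebra_simps)
    finally show ?thesis by (metis eis_ring_memI)
  qed
  have neg: "- x \<in> carrier eis_ring" if x: "x \<in> carrier eis_ring" for x
  proof -
    obtain a b where "x = of_int a + of_int b * eis_omega"
      using x by (rule eis_ring_memE)
    then have "- x = of_int (- a) + of_int (- b) * eis_omega"
      by simp
    then show ?thesis by (metis eis_ring_memI)
  qed
  have zero: "0 \<in> carrier eis_ring" and one: "1 \<in> carrier eis_ring"
    using eis_ring_memI[of 0 0] eis_ring_memI[of 1 0] by simp_all
  have sel: "x \<otimes>\<^bsub>eis_ring\<^esub> y = x * y" "x \<oplus>\<^bsub>eis_ring\<^esub> y = x + y"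
    "\<one>\<^bsub>eis_ring\<^esub> = 1" "\<zero>\<^bsub>eis_ring\<^esub> = 0" for x y
    by (simp_all add: eis_ring_def)
  have "cring eis_ring"
  proof (rule cringI)
    show "abelian_group eis_ring"
      by (rule abelian_groupI)
        (use add zero neg in \<open>auto simp: sel intro: bexI[of _ "- x" for x]\<close>)
    show "Group.comm_monoid eis_ring"
      by (rule comm_monoidI) (use mult one in \<open>auto simp: sel\<close>)
  qed (simp add: sel algebra_simps)
  then show ?thesis
    by (rule domain.intro) (auto simp: domain_axioms_def sel)
qed

end

(* Divisibility by the elements in question is decided on coordinates, so their primality reduces
   to primality in the integers, without unique factorisation in D. If q = 2 (mod 3), cubing is
   injective modulo q, hence q divides a^2 - a b + b^2 = N(a + b omega) only if it divides both a
   and b; multiplicativity of the norm then makes q prime in D. An element of prime norm p is prime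
   because its residue ring is the field with p elements, which covers 1 - omega. If p = 1 (mod 3),
   there is r with r^2 - r + 1 = 0 (mod p), and Thue's lemma gives a = r b (mod p) with a^2, b^2 < p,
   not both zero. Then a^2 - a b + b^2 is p or 2 p, and 2 p is excluded because 2 is inert. *)

theory Submission
  imports Defs "HOL-Library.Discrete_Functions" "HOL-Number_Theory.Residue_Primitive_Roots"
begin

section \<open>Multiplication and divisibility in coordinates\<close>

lemma eis_ring_simps:
  "x \<otimes>\<^bsub>eis_ring\<^esub> y = x * y" "x \<oplus>\<^bsub>eis_ring\<^esub> y = x + y"
  "\<one>\<^bsub>eis_ring\<^esub> = 1" "\<zero>\<^bsub>eis_ring\<^esub> = 0"
  by (simp_all add: eis_ring_def)

lemma eis_mult:
  "(of_int a + of_int b * eis_omega) * (of_int c + of_int d * eis_omega) =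
    of_int (a * c - b * d) + of_int (a * d + b * c - b * d) * eis_omega"
proof -
  have "(of_int a + of_int b * eis_omega) * (of_int c + of_int d * eis_omega) =
      of_int a * of_int c + (of_int a * of_int d + of_int b * of_int c) * eis_omega
        + of_int b * of_int d * eis_omega\<^sup>2"
    by (simp add: power2_eq_square algebra_simps)
  then show ?thesis
    by (simp add: eis_omega_squared algebra_simps)
qed

lemma eis_coords_eq_iff:
  "of_int a + of_int b * eis_omega = of_int c + of_int d * eis_omega \<longleftrightarrow> a = c \<and> b = d"
  by (auto simp: eis_omega_def complex_eq_iff)

lemma eis_divides_iff:
  "(of_int a + of_int b * eis_omega) divides\<^bsub>eis_ring\<^esub> (of_int c + of_int d * eis_omega) \<longleftrightarrow>
    (\<exists>e f. c = a * e - b * f \<and> d = a * f + b * e - b * f)"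
proof -
  have "(of_int a + of_int b * eis_omega) divides\<^bsub>eis_ring\<^esub> (of_int c + of_int d * eis_omega) \<longleftrightarrow>
      (\<exists>e f. of_int c + of_int d * eis_omega =
        (of_int a + of_int b * eis_omega) * (of_int e + of_int f * eis_omega))"
    by (auto simp: factor_def eis_ring_def)
  then show ?thesis
    by (simp only: eis_mult eis_coords_eq_iff)
qed

text \<open>Reduces primality to integer arithmetic once divisibility by \<open>x\<close> is
  expressed by a predicate \<open>P\<close> on coordinates. The arguments of \<open>P\<close> in the
  premise of \<open>mult\<close> are the coordinates of the product of \<open>c + d\<omega>\<close>
  and \<open>e + f\<omega>\<close>; \<open>\<not> P 1 0\<close> keeps \<open>x\<close> from being a
  unit.\<close>

lemma eis_primeI:
  assumes "x \<in> carrier eis_ring" "x \<noteq> 0"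
    and divs: "\<And>c d. x divides\<^bsub>eis_ring\<^esub> (of_int c + of_int d * eis_omega) \<longleftrightarrow> P c d"
    and one: "\<not> P 1 0"
    and mult: "\<And>c d e f. P (c * e - d * f) (c * f + d * e - d * f) \<Longrightarrow> P c d \<or> P e f"
  shows "eis_prime x"
proof -
  have "x \<notin> Units eis_ring"
  proof
    assume "x \<in> Units eis_ring"
    then obtain y where "y \<in> carrier eis_ring" "x * y = 1"
      by (auto simp: Units_def eis_ring_simps)
    then have "x divides\<^bsub>eis_ring\<^esub> 1"
      by (auto simp: factor_def eis_ring_simps intro!: bexI[of _ y])
    then show False
      using divs[of 1 0] one by simp
  qed
  moreover have "x divides\<^bsub>eis_ring\<^esub> y \<or> x divides\<^bsub>eis_ring\<^esub> z"
    if yz: "y \<in> carrier eis_ring" "z \<in> carrier eis_ring" and xyz: "x divides\<^bsub>eis_ring\<^esub> (y * z)" for y z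
  proof -
    obtain c d e f where "y = of_int c + of_int d * eis_omega" "z = of_int e + of_int f * eis_omega"
      using yz by (metis eis_ring_memE)
    then show ?thesis
      using xyz mult by (simp only: eis_mult divs)
  qed
  ultimately show ?thesis
    using assms(1,2) by (simp add: eis_prime_def ring_prime_def Divisibility.prime_def eis_ring_simps)
qed

section \<open>Elements of prime norm\<close>

text \<open>
  The residue field of \<open>a + b\<omega>\<close> is \<open>\<int>/p\<close> with \<open>\<omega> \<mapsto> - a / b\<close>, so that divisibility of
  \<open>c + d\<omega>\<close> amounts to \<open>a d \<equiv> b c\<close> modulo \<open>p\<close>.
\<close>
lemma eis_prime_of_norm_prime:
  fixes a b :: int
  assumes p: "Factorial_Ring.prime (a\<^sup>2 - a * b + b\<^sup>2)"
  shows "eis_prime (of_int a + of_int b * eis_omega)"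
proof (rule eis_primeI[where P = "\<lambda>c d. (a\<^sup>2 - a * b + b\<^sup>2) dvd (a * d - b * c)"])
  let ?p = "a\<^sup>2 - a * b + b\<^sup>2"
  \<comment> \<open>The residue map needs \<open>b\<close> invertible modulo \<open>?p\<close>.
    Otherwise \<open>?p\<close> would divide \<open>a\<close> as well, and its square would divide
    \<open>?p\<close>.\<close>
  have nb: "\<not> ?p dvd b"
  proof
    assume b: "?p dvd b"
    then have "?p dvd ?p + (a - b) * b"
      by simp
    then have "?p dvd a\<^sup>2"
      by (simp add: power2_eq_square algebra_simps)
    then have "?p dvd a"
      using p prime_dvd_power by blast
    then have "?p * ?p dvd a * a" "?p * ?p dvd a * b" "?p * ?p dvd b * b"
      using b by (auto intro: mult_dvd_mono)
    then have "?p * ?p dvd ?p"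
      unfolding power2_eq_square by (intro dvd_add dvd_diff)
    moreover have "?p > 1"
      using p by (rule prime_gt_1_int)
    ultimately show False
      by simp
  qed
  show "of_int a + of_int b * eis_omega \<in> carrier eis_ring"
    by (rule eis_ring_memI)
  show "of_int a + of_int b * eis_omega \<noteq> 0"
    using p eis_coords_eq_iff[of a b 0 0] by auto
  show "(of_int a + of_int b * eis_omega) divides\<^bsub>eis_ring\<^esub> (of_int c + of_int d * eis_omega) \<longleftrightarrow>
      ?p dvd (a * d - b * c)" for c d
    unfolding eis_divides_iff
  proof
    assume "\<exists>e f. c = a * e - b * f \<and> d = a * f + b * e - b * f"
    then obtain e f where "c = a * e - b * f" "d = a * f + b * e - b * f"
      by blast
    then have "a * d - b * c = ?p * f"
      by (simp only: power2_eq_square) (simp add: algebra_simps)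
    then show "?p dvd (a * d - b * c)"
      by simp
  next
    assume "?p dvd (a * d - b * c)"
    then obtain f where f: "a * d - b * c = ?p * f"
      by auto
    \<comment> \<open>The numbers \<open>a c - b c + b d\<close> and \<open>a d - b c\<close> are
      the coordinates of \<open>c + d\<omega>\<close> times the conjugate of
      \<open>a + b\<omega>\<close>. Divided by \<open>?p\<close>, they are the coordinates
      \<open>e\<close> and \<open>f\<close> of the quotient. Divisibility of the second forces that
      of the first because \<open>b\<close> can be cancelled.\<close>
    have "b * (a * c - b * c + b * d) = ?p * d - (a - b) * (a * d - b * c)"
      by (simp add: power2_eq_square algebra_simps)
    also have "\<dots> = ?p * (d - (a - b) * f)"
      by (simp add: f algebra_simps)
    finally have "?p dvd a * c - b * c + b * d"
      using nb p prime_dvd_mult_iff dvd_triv_left by metis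
    then obtain e where e: "a * c - b * c + b * d = ?p * e"
      by auto
    have "?p * c = a * (a * c - b * c + b * d) - b * (a * d - b * c)"
      by (simp add: power2_eq_square algebra_simps)
    also have "\<dots> = ?p * (a * e - b * f)"
      by (simp only: e f) (simp add: algebra_simps)
    finally have c: "c = a * e - b * f"
      using p by (simp only: mult_cancel_left) auto
    have "?p * d = (a - b) * (a * d - b * c) + b * (a * c - b * c + b * d)"
      by (simp add: power2_eq_square algebra_simps)
    also have "\<dots> = ?p * (a * f + b * e - b * f)"
      by (simp only: e f) (simp add: algebra_simps)
    finally have d: "d = a * f + b * e - b * f"
      using p by (simp only: mult_cancel_left) auto
    from c d show "\<exists>e f. c = a * e - b * f \<and> d = a * f + b * e - b * f"
      by blast
  qed
  show "\<not> ?p dvd (a * 0 - b * 1)"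
    using nb by simp
  show "?p dvd (a * d - b * c) \<or> ?p dvd (a * f - b * e)"
    if "?p dvd (a * (c * f + d * e - d * f) - b * (c * e - d * f))" for c d e f
  proof -
    \<comment> \<open>Modulo \<open>?p\<close>, \<open>a d - b c\<close> is \<open>- b\<close> times
      the residue of \<open>c + d\<omega>\<close>. Multiplicativity of the residue map therefore
      shows up with an extra factor \<open>- b\<close>.\<close>
    have "(a * d - b * c) * (a * f - b * e) =
        ?p * (d * f) - b * (a * (c * f + d * e - d * f) - b * (c * e - d * f))"
      by (simp add: power2_eq_square algebra_simps)
    then have "?p dvd (a * d - b * c) * (a * f - b * e)"
      using that by simp
    then show ?thesis
      using p prime_dvd_mult_iff by blast
  qed
qed

section \<open>Inert primes\<close>

lemma fermat_theorem_int:
  fixes p x :: int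
  assumes p: "Factorial_Ring.prime p" and x: "\<not> p dvd x"
  shows "[x ^ (nat p - 1) = 1] (mod p)"
proof -
  have p0: "p > 0" using p by (rule prime_gt_0_int)
  have "\<not> nat p dvd nat (x mod p)"
    using x p0 by (simp add: nat_dvd_iff dvd_mod_iff)
  then have "[nat (x mod p) ^ (nat p - 1) = 1] (mod nat p)"
    using p by (intro fermat_theorem) auto
  then have "[(x mod p) ^ (nat p - 1) = 1] (mod p)"
    using p0 by (simp flip: cong_int_iff)
  then show ?thesis
    by (simp add: cong_def power_mod)
qed

text \<open>The form divides \<open>a ^ 3 + b ^ 3\<close>, so \<open>a ^ 3\<close> and
  \<open>- (b ^ 3)\<close> agree modulo \<open>q\<close>. If \<open>q\<close> divides neither
  number, write \<open>q = 3 * k + 2\<close>: taking \<open>k\<close>-th powers and comparing with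
  Fermat's theorem for the exponent \<open>q - 1 = 3 * k + 1\<close> gives \<open>a = - b\<close>
  modulo \<open>q\<close>. Then \<open>q\<close> divides \<open>3 * a * b\<close>, hence 3, which is
  impossible.\<close>

lemma prime_dvd_eisenstein_form:
  fixes q a b :: int
  assumes q: "Factorial_Ring.prime q" and q2: "[q = 2] (mod 3)"
    and dvd: "q dvd a\<^sup>2 - a * b + b\<^sup>2"
  shows "q dvd a" "q dvd b"
proof -
  have swap: "q dvd y" if "q dvd x" "q dvd x\<^sup>2 - x * y + y\<^sup>2" for x y
  proof -
    have "q dvd (x\<^sup>2 - x * y + y\<^sup>2) - x * (x - y)"
      using that by auto
    then have "q dvd y\<^sup>2"
      by (simp add: power2_eq_square algebra_simps)
    then show ?thesis
      using q prime_dvd_power by blast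
  qed
  have "q dvd a"
  proof (rule ccontr)
    assume na: "\<not> q dvd a"
    then have nb: "\<not> q dvd b"
      using swap[of b a] dvd by (auto simp: algebra_simps)
    define k where "k = nat (q div 3)"
    have q_eq: "q = 3 * int k + 2"
      using q2 prime_gt_1_int[OF q] by (simp add: k_def cong_def pos_imp_zdiv_nonneg_iff) presburger
    have fermat: "[x ^ (3 * k + 1) = 1] (mod q)" if "\<not> q dvd x" for x
      using fermat_theorem_int[OF q that] by (simp add: q_eq nat_add_distrib nat_mult_distrib)
    have "a ^ 3 - (- (b ^ 3)) = (a + b) * (a\<^sup>2 - a * b + b\<^sup>2)"
      by (simp add: power2_eq_square power3_eq_cube algebra_simps)
    then have "[a ^ 3 = - (b ^ 3)] (mod q)"
      using dvd by (simp add: cong_iff_dvd_diff)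
    then have "[(a ^ 3) ^ k * a = ((- (b ^ 3)) ^ k) * a] (mod q)"
      by (intro cong_mult cong_pow cong_refl)
    moreover have "[(a ^ 3) ^ k * a = (b ^ 3) ^ k * b] (mod q)"
      using cong_trans[OF fermat[OF na] cong_sym[OF fermat[OF nb]]]
      by (simp only: power_add power_mult power_one_right)
    moreover have "(- (b ^ 3)) ^ k = (b ^ 3) ^ k * (- 1) ^ k"
      by (subst power_minus) (rule mult.commute)
    ultimately have "[(b ^ 3) ^ k * ((- 1) ^ k * a) = (b ^ 3) ^ k * b] (mod q)"
      by (simp add: cong_def mult.assoc)
    moreover have "coprime ((b ^ 3) ^ k) q"
      using prime_imp_coprime[OF q nb] by (simp add: coprime_commute)
    ultimately have ab: "[(- 1) ^ k * a = b] (mod q)"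
      using cong_mult_lcancel by blast
    \<comment> \<open>For even \<open>k\<close>, \<open>q\<close> is even, so \<open>q = 2\<close>
      and signs do not matter. For odd \<open>k\<close> the sign is the right one.\<close>
    have "q dvd a + b"
    proof (cases "even k")
      case True
      then have "even q" by (simp add: q_eq)
      then have "q = 2" using q primes_dvd_imp_eq[of 2 q] by simp
      then show ?thesis using ab True by (auto simp: cong_iff_dvd_diff)
    next
      case False
      then have "q dvd - (a + b)" using ab by (simp add: cong_iff_dvd_diff)
      then show ?thesis by (simp only: dvd_minus_iff)
    qed
    then have "q dvd (a + b) * (a + b) - (a\<^sup>2 - a * b + b\<^sup>2)"
      using dvd by (intro dvd_diff dvd_mult2)
    then have "q dvd 3 * (a * b)"
      by (simp add: power2_eq_square algebra_simps)
    then have "q dvd 3"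
      using na nb q by (simp add: prime_dvd_mult_iff)
    moreover from this have "q \<le> 3" by (simp add: zdvd_imp_le)
    then have "q = 2" using q_eq by presburger
    ultimately show False by simp
  qed
  then show "q dvd a" "q dvd b"
    using swap[OF _ dvd] by simp_all
qed

lemma eis_prime_inert:
  fixes q :: int
  assumes q: "Factorial_Ring.prime q" and q2: "[q = 2] (mod 3)"
  shows "eis_prime (of_int q)"
proof (rule eis_primeI[where P = "\<lambda>c d. q dvd c \<and> q dvd d"])
  show "of_int q \<in> carrier eis_ring"
    using eis_ring_memI[of q 0] by simp
  show "(of_int q :: complex) \<noteq> 0"
    using q by auto
  show "of_int q divides\<^bsub>eis_ring\<^esub> (of_int c + of_int d * eis_omega) \<longleftrightarrow> q dvd c \<and> q dvd d" for c d
    using eis_divides_iff[of q 0 c d] by (auto simp: dvd_def)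
  show "\<not> (q dvd 1 \<and> q dvd 0)"
    using q not_prime_unit by blast
  show "(q dvd c \<and> q dvd d) \<or> (q dvd e \<and> q dvd f)"
    if "q dvd c * e - d * f \<and> q dvd c * f + d * e - d * f" for c d e f
  proof -
    let ?u = "c * e - d * f" and ?v = "c * f + d * e - d * f"
    \<comment> \<open>\<open>?u\<close> and \<open>?v\<close> are the coordinates of the product, so
      \<open>q\<close> divides its norm. By multiplicativity \<open>q\<close> divides the norm of
      one factor, and hence both coordinates of that factor.\<close>
    have "q dvd ?u\<^sup>2 - ?u * ?v + ?v\<^sup>2"
      using that by (simp add: power2_eq_square)
    also have "?u\<^sup>2 - ?u * ?v + ?v\<^sup>2 = (c\<^sup>2 - c * d + d\<^sup>2) * (e\<^sup>2 - e * f + f\<^sup>2)"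
      by (simp add: power2_eq_square algebra_simps)
    finally show ?thesis
      using prime_dvd_eisenstein_form[OF q q2] q prime_dvd_mult_iff by blast
  qed
qed

section \<open>Primes congruent to 1 modulo 3 as norms\<close>

text \<open>Pigeonhole: with \<open>k\<close> the integer square root of \<open>p\<close>, the
  \<open>(k + 1)^2 > p\<close> pairs \<open>(x, y)\<close> yield at most \<open>p\<close> residues
  of \<open>x - r * y\<close>. The difference of two colliding pairs has entries of absolute value
  at most \<open>k\<close>.\<close>

lemma thue_lemma:
  fixes p r :: int
  assumes p: "Factorial_Ring.prime p"
  obtains a b :: int where "(a, b) \<noteq> (0, 0)" "p dvd a - r * b" "a\<^sup>2 < p" "b\<^sup>2 < p"
proof -
  define k where "k = floor_sqrt (nat p)"
  have p1: "p > 1" using p by (rule prime_gt_1_int)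
  have k_le: "k\<^sup>2 \<le> nat p" and k_gt: "nat p < (Suc k)\<^sup>2"
    unfolding k_def using Suc_floor_sqrt_power2_gt by auto
  define f where "f = (\<lambda>(x, y). (int x - r * int y) mod p)"
  have "f ` ({..k} \<times> {..k}) \<subseteq> {0..<p}"
    using p1 by (auto simp: f_def)
  then have "card (f ` ({..k} \<times> {..k})) \<le> nat p"
    by (metis card_atLeastLessThan_int card_mono diff_zero finite_atLeastLessThan_int)
  also have "\<dots> < card ({..k} \<times> {..k})"
    using k_gt by (simp add: power2_eq_square)
  finally have "\<not> inj_on f ({..k} \<times> {..k})"
    by (rule pigeonhole)
  then obtain x y u v where le: "x \<le> k" "y \<le> k" "u \<le> k" "v \<le> k"
    and ne: "(x, y) \<noteq> (u, v)" and eq: "f (x, y) = f (u, v)"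
    unfolding inj_on_def by auto
  have sq: "(int i - int j)\<^sup>2 < p" if "i \<le> k" "j \<le> k" for i j
  proof -
    have "(int i - int j)\<^sup>2 \<le> (int k)\<^sup>2"
      using that by (intro abs_le_square_iff[THEN iffD1]) auto
    also have "\<dots> \<le> p"
      using k_le p1 by (simp add: le_nat_iff)
    finally have "(int i - int j)\<^sup>2 \<le> p" .
    \<comment> \<open>A prime is not a square, which makes the bound strict.\<close>
    moreover have "(int i - int j)\<^sup>2 \<noteq> p"
      using p by (auto simp: prime_power_iff)
    ultimately show ?thesis by simp
  qed
  show ?thesis
  proof
    show "(int x - int u, int y - int v) \<noteq> (0, 0)"
      using ne by auto
    show "p dvd (int x - int u) - r * (int y - int v)"
      using eq by (simp add: f_def mod_eq_dvd_iff algebra_simps)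
  qed (use sq le in auto)
qed

text \<open>A primitive root raised to the power \<open>(p - 1) / 3\<close> is a cube root of unity
  \<open>h\<close> other than 1, hence a zero of \<open>x^2 + x + 1\<close> modulo \<open>p\<close>.
  The witness is \<open>r = - h\<close>.\<close>

lemma sixth_root_of_unity_mod_prime:
  fixes p :: int
  assumes p: "Factorial_Ring.prime p" and p1: "[p = 1] (mod 3)"
  obtains r where "p dvd r\<^sup>2 - r + 1"
proof -
  have p1': "p > 1" using p by (rule prime_gt_1_int)
  define k where "k = nat (p div 3)"
  have p_eq: "p = 3 * int k + 1"
    using p1 p1' by (simp add: k_def cong_def pos_imp_zdiv_nonneg_iff) presburger
  then have np: "nat p = 3 * k + 1" and k: "k > 0"
    using p1' by auto
  have pn: "Factorial_Ring.prime (nat p)" using p by simp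
  then obtain g where "residue_primroot (nat p) g"
    using prime_primitive_root_exists[of "nat p"] p1' by auto
  then have ord: "ord (nat p) g = 3 * k"
    using pn np by (simp add: residue_primroot_def totient_prime)
  define h where "h = int g ^ k"
  have "[g ^ (3 * k) = 1] (mod nat p)"
    by (simp only: ord_divides ord dvd_refl)
  then have "[int g ^ (3 * k) = 1] (mod p)"
    using p1' by (simp flip: cong_int_iff)
  then have "p dvd h ^ 3 - 1"
    by (simp add: h_def cong_iff_dvd_diff mult.commute flip: power_mult)
  also have "h ^ 3 - 1 = (h - 1) * (h\<^sup>2 + h + 1)"
    by (simp add: power2_eq_square power3_eq_cube algebra_simps)
  finally have "p dvd h - 1 \<or> p dvd h\<^sup>2 + h + 1"
    using p prime_dvd_mult_iff by blast
  moreover have "\<not> p dvd h - 1"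
  proof
    assume "p dvd h - 1"
    then have "[int (g ^ k) = int 1] (mod int (nat p))"
      using p1' by (simp add: h_def cong_iff_dvd_diff)
    then have "3 * k dvd k"
      by (simp only: cong_int_iff ord_divides ord)
    then show False using k by (auto dest: dvd_imp_le)
  qed
  ultimately show ?thesis
    using that[of "- h"] by simp
qed

lemma prime_eisenstein_form:
  fixes p :: int
  assumes p: "Factorial_Ring.prime p" and p1: "[p = 1] (mod 3)"
  obtains a b where "p = a\<^sup>2 - a * b + b\<^sup>2"
proof -
  obtain r where r: "p dvd r\<^sup>2 - r + 1"
    using sixth_root_of_unity_mod_prime[OF p p1] .
  obtain a b where ne: "(a, b) \<noteq> (0, 0)" and dvd: "p dvd a - r * b"
    and sq: "a\<^sup>2 < p" "b\<^sup>2 < p"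
    using thue_lemma[OF p] .
  let ?n = "a\<^sup>2 - a * b + b\<^sup>2"
  \<comment> \<open>Putting \<open>a = r * b\<close> turns the form into
    \<open>(r^2 - r + 1) * b^2\<close>; the first summand is the correction for the
    congruence.\<close>
  have "?n = (a - r * b) * (a + r * b - b) + (r\<^sup>2 - r + 1) * b\<^sup>2"
    by (simp add: power2_eq_square algebra_simps)
  then have "p dvd ?n"
    using dvd r by simp
  then obtain m where m: "?n = p * m" by auto
  have four: "4 * ?n = (2 * a - b)\<^sup>2 + 3 * b\<^sup>2"
    by (simp add: power2_eq_square algebra_simps)
  have "?n > 0"
  proof (cases "b = 0")
    case True
    then show ?thesis using ne by simp
  next
    case False
    then have "b\<^sup>2 > 0" by simp
    then have "0 < 4 * ?n"
      unfolding four by (intro add_nonneg_pos) simp_all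
    then show ?thesis by (simp only: zero_less_mult_iff) simp
  qed
  \<comment> \<open>From \<open>(a + b)^2 \<ge> 0\<close> follows
    \<open>- a * b \<le> (a^2 + b^2) / 2\<close>, so \<open>?n\<close> is at most
    \<open>3 / 2 * (a^2 + b^2)\<close>.\<close>
  moreover have "?n < 3 * p"
    using sq zero_le_power2[of "a + b"] by (simp add: power2_sum) 
  ultimately have "p * 0 < p * m" "p * m < p * 3"
    by (simp_all only: m mult_zero_right mult.commute[of 3 p])
  then have "m = 1 \<or> m = 2"
    using prime_gt_0_int[OF p] by (simp only: mult_less_cancel_left_pos) linarith
  moreover have "m \<noteq> 2"
  proof
    assume "m = 2"
    then have even_n: "even ?n" by (simp add: m)
    \<comment> \<open>The inert prime here is 2. Both numbers being even, 4 divides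
      \<open>?n = 2 * p\<close>, so \<open>p\<close> would be 2.\<close>
    have "even a" "even b"
      by (rule prime_dvd_eisenstein_form[OF _ cong_refl even_n], simp)+
    then have "2 * 2 dvd a * a" "2 * 2 dvd a * b" "2 * 2 dvd b * b"
      by (simp_all only: mult_dvd_mono)
    then have "2 * 2 dvd ?n"
      unfolding power2_eq_square by (intro dvd_add dvd_diff)
    then have "2 dvd p" by (simp add: m \<open>m = 2\<close>) presburger
    then have "p = 2" using p primes_dvd_imp_eq[of 2 p] by simp
    with p1 show False by (simp add: cong_def)
  qed
  ultimately have "m = 1"
    by blast
  with m have "p = ?n"
    by simp
  then show ?thesis
    by (rule that)
qed

theorem theorem3p4:
  fixes p q :: int
  assumes "Factorial_Ring.prime p" and "Factorial_Ring.prime q"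
  shows "([q = 2] (mod 3) \<longrightarrow> eis_prime (of_int q))
    \<and> ([p = 1] (mod 3) \<longrightarrow>
        (\<exists>\<pi>. eis_prime \<pi> \<and> of_int p = eis_norm \<pi> \<and> eis_norm \<pi> = \<pi> * cnj \<pi>))
    \<and> (3 :: complex) = - (eis_omega\<^sup>2) * (1 - eis_omega)\<^sup>2
    \<and> eis_prime (1 - eis_omega)"
proof (intro conjI impI)
  assume "[q = 2] (mod 3)"
  then show "eis_prime (of_int q)"
    by (rule eis_prime_inert[OF assms(2)])
next
  assume "[p = 1] (mod 3)"
  then obtain a b where ab: "p = a\<^sup>2 - a * b + b\<^sup>2"
    using prime_eisenstein_form[OF assms(1)] by blast
  then have "eis_prime (of_int a + of_int b * eis_omega)"
    using assms(1) eis_prime_of_norm_prime by simp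
  then show "\<exists>\<pi>. eis_prime \<pi> \<and> of_int p = eis_norm \<pi> \<and> eis_norm \<pi> = \<pi> * cnj \<pi>"
    using ab eis_norm_eq eis_norm_def by metis
next
  show "(3 :: complex) = - (eis_omega\<^sup>2) * (1 - eis_omega)\<^sup>2"
  proof -
    \<comment> \<open>The element \<open>\<omega> * (1 - \<omega>) = 1 + 2 * \<omega>\<close> is the
      square root \<open>i * sqrt 3\<close> of -3.\<close>
    have "- (eis_omega\<^sup>2) * (1 - eis_omega)\<^sup>2 = - (eis_omega - eis_omega\<^sup>2)\<^sup>2"
      by (simp add: power2_eq_square algebra_simps)
    also have "\<dots> = - (1 + 2 * eis_omega)\<^sup>2"
      by (simp add: eis_omega_squared algebra_simps)
    also have "\<dots> = - (1 + 4 * eis_omega + 4 * eis_omega\<^sup>2)"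
      by (simp add: power2_eq_square algebra_simps)
    finally show ?thesis
      by (simp add: eis_omega_squared)
  qed
next
  show "eis_prime (1 - eis_omega)"
    \<comment> \<open>The coordinates 1 and -1 give the norm \<open>1 + 1 + 1 = 3\<close>.\<close>
    using eis_prime_of_norm_prime[of 1 "- 1"] by simp
qed

end
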